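(* Let $n$ be a positive integer, and let $\theta(n)$ denote the number of all cinema mappings with $n$ seats. Then $\theta(n)\leqslant\prod_{i=1}^n\tau(i)$, where $\tau(i)=\sum_{d\mid i}1$ is the number of positive divisors of $i$.
   Context: For a positive integer $n$, $[n]=\{1,\dots,n\}$. Cinema problem: a cinema has seats $1,\dots,n$ and people with tickets $1,\dots,n$ enter in this order; person $i$ may choose any unoccupied seat whose number is a multiple of $i$, and leaves only if all those seats are already occupied by previous people. Formally, a cinema mapping with $n$ seats is an injective map $\sigma:D_\sigma\to R_\sigma$, where $D_\sigma\subseteq[n]$ and $R_\sigma=\sigma(D_\sigma)\subseteq[n]$, such that: (divisor-first) if $i\mid j$ and $j\in D_\sigma$ then $i\in D_\sigma$; (seat-multiple-ticket) $i\mid\sigma(i)$ for each $i\in D_\sigma$; and (exit rule) if $i\in[n]\setminus D_\sigma$ then every multiple of $i$ in $[n]$ equals $\sigma(j)$ for some $j\in D_\sigma$ with $j<i$. The function $\theta$ is called the total cinema function. *)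

theory Defs
  imports Main
begin

(* A map D \<rightarrow> R with D, R \<subseteq> [n] and R = \<sigma>(D) is a partial function with domain D and range R.
   Distinct maps are then distinct partial functions, so that counting them is literal. *)
definition cinema_mapping :: "nat \<Rightarrow> (nat \<rightharpoonup> nat) \<Rightarrow> bool" where
  "cinema_mapping n \<sigma> \<longleftrightarrow>
     dom \<sigma> \<subseteq> {1..n} \<and> ran \<sigma> \<subseteq> {1..n} \<and> inj_on \<sigma> (dom \<sigma>) \<and>
     (\<forall>i j. i dvd j \<and> j \<in> dom \<sigma> \<longrightarrow> i \<in> dom \<sigma>) \<and>
     (\<forall>i \<in> dom \<sigma>. i dvd the (\<sigma> i)) \<and>
     (\<forall>i \<in> {1..n} - dom \<sigma>. \<forall>m \<in> {1..n}. i dvd m \<longrightarrow> (\<exists>j \<in> dom \<sigma>. j < i \<and> \<sigma> j = Some m))"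

definition total_cinema :: "nat \<Rightarrow> nat" where
  "total_cinema n = card {\<sigma>. cinema_mapping n \<sigma>}"

(* By the following, the cardinality above is a genuine count. *)
lemma finite_cinema_mappings: "finite {\<sigma>. cinema_mapping n \<sigma>}"
proof (rule finite_subset)
  show "{\<sigma>. cinema_mapping n \<sigma>} \<subseteq> (\<Union>A \<in> Pow {1..n}. {\<sigma>. dom \<sigma> = A \<and> ran \<sigma> \<subseteq> {1..n}})"
    by (auto simp: cinema_mapping_def)
  show "finite (\<Union>A \<in> Pow {1..n}. {\<sigma> :: nat \<rightharpoonup> nat. dom \<sigma> = A \<and> ran \<sigma> \<subseteq> {1..n}})"
    by (auto intro!: finite_set_of_finite_maps intro: finite_subset)
qed

(* Intended for positive arguments: the divisors of 0 form an infinite set, giving 0. *)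
definition tau :: "nat \<Rightarrow> nat" where
  "tau i = (\<Sum>d | d dvd i. 1)"

end

theory Submission
  imports Defs "HOL-Library.FuncSet"
begin

text \<open>
  A cinema mapping is encoded by writing on each seat \<open>m\<close> a divisor of \<open>m\<close>: the ticket of its
  occupant or, if the seat stays empty, the number \<open>m\<close> itself. There are \<open>\<Prod>i = 1..n. tau i\<close>
  ways to write a divisor on every seat, so it is enough that the mapping can be recovered from
  its encoding.

  The only ambiguity is a seat \<open>m\<close> that carries its own number: either person \<open>m\<close> sits there or
  the seat is empty. If it is empty, then by the exit rule person \<open>m\<close> did not leave, and thus sits
  on another seat, which then also carries \<open>m\<close>. If person \<open>m\<close> sits on seat \<open>m\<close>, no other seat
  carries \<open>m\<close>. So a seat that carries its own number is empty exactly if another seat carries it too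
  (lemma \<open>cinema_mapping_decode\<close>).
\<close>

definition seat_labels :: "nat \<Rightarrow> (nat \<rightharpoonup> nat) \<Rightarrow> nat \<Rightarrow> nat" where
  "seat_labels n \<sigma> = (\<lambda>m\<in>{1..n}. if \<exists>i. \<sigma> i = Some m then SOME i. \<sigma> i = Some m else m)"

lemma seat_labels_occupied:
  assumes "cinema_mapping n \<sigma>" "\<sigma> i = Some m"
  shows "seat_labels n \<sigma> m = i"
proof -
  have "m \<in> {1..n}"
    using assms by (auto simp: cinema_mapping_def intro: ranI)
  moreover have "(SOME i. \<sigma> i = Some m) = i"
  proof (rule some_equality)
    show "j = i" if "\<sigma> j = Some m" for j
      using assms that by (auto simp: cinema_mapping_def inj_on_def dom_def)
  qed (fact assms(2))
  ultimately show ?thesis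
    using assms(2) by (auto simp: seat_labels_def)
qed

lemma seat_labels_empty:
  assumes "m \<in> {1..n}" "\<nexists>i. \<sigma> i = Some m"
  shows "seat_labels n \<sigma> m = m"
  using assms by (simp add: seat_labels_def)

lemma seat_labels_dvd:
  assumes "cinema_mapping n \<sigma>" "m \<in> {1..n}"
  shows "seat_labels n \<sigma> m dvd m"
proof (cases "\<exists>i. \<sigma> i = Some m")
  case True
  then obtain i where i: "\<sigma> i = Some m" ..
  then have "i dvd m"
    using assms(1) unfolding cinema_mapping_def by (metis domI option.sel)
  then show ?thesis
    using seat_labels_occupied[OF assms(1) i] by simp
next
  case False
  then show ?thesis
    using seat_labels_empty[OF assms(2)] by simp
qed

lemma empty_seat_imp_seated:
  assumes "cinema_mapping n \<sigma>" "m \<in> {1..n}" "\<nexists>i. \<sigma> i = Some m"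
  shows "m \<in> dom \<sigma>"
  using assms unfolding cinema_mapping_def by (metis DiffI dvd_refl)

text \<open>
  The right-hand side mentions \<open>\<sigma>\<close> only through its labels, which makes the encoding injective.
  A label different from the seat's own number always names the occupant; the last conjunct
  decides whether a seat carrying its own number is occupied.
\<close>
lemma cinema_mapping_decode:
  assumes "cinema_mapping n \<sigma>"
  shows "\<sigma> i = Some m \<longleftrightarrow>
    m \<in> {1..n} \<and> seat_labels n \<sigma> m = i \<and>
    (i = m \<longrightarrow> (\<forall>k\<in>{1..n}. seat_labels n \<sigma> k = m \<longrightarrow> k = m))"
    (is "?L \<longleftrightarrow> ?R")
proof
  assume L: ?L
  have "m \<in> {1..n}"
    using assms L by (auto simp: cinema_mapping_def intro: ranI)
  moreover have "k = m" if "i = m" "k \<in> {1..n}" "seat_labels n \<sigma> k = m" for k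
  proof (cases "\<exists>j. \<sigma> j = Some k")
    case True
    then have "\<sigma> m = Some k"
      using seat_labels_occupied[OF assms] that(3) by blast
    then show ?thesis
      using L that(1) by simp
  next
    case False
    then show ?thesis
      using seat_labels_empty that by metis
  qed
  ultimately show ?R
    using seat_labels_occupied[OF assms L] by blast
next
  assume R: ?R
  show ?L
  proof (cases "\<exists>j. \<sigma> j = Some m")
    case True
    then show ?thesis
      using seat_labels_occupied[OF assms] R by blast
  next
    case False
    then have "i = m"
      using seat_labels_empty R by metis
    obtain k where k: "\<sigma> m = Some k"
      using empty_seat_imp_seated[OF assms _ False] R by blast
    then have "k \<in> {1..n}"
      using assms by (auto simp: cinema_mapping_def intro: ranI)
    then have "k = m"
      using R \<open>i = m\<close> seat_labels_occupied[OF assms k] by blast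
    then show ?thesis
      using k False by blast
  qed
qed

lemma inj_on_seat_labels: "inj_on (seat_labels n) {\<sigma>. cinema_mapping n \<sigma>}"
proof (rule inj_onI, clarify)
  fix \<sigma> \<sigma>'
  assume *: "cinema_mapping n \<sigma>" "cinema_mapping n \<sigma>'" "seat_labels n \<sigma> = seat_labels n \<sigma>'"
  have "\<sigma> i = Some m \<longleftrightarrow> \<sigma>' i = Some m" for i m
    unfolding cinema_mapping_decode[OF *(1)] cinema_mapping_decode[OF *(2)] *(3) ..
  then show "\<sigma> = \<sigma>'"
    by (intro ext option.expand) (metis not_None_eq option.sel)+
qed

theorem corollary3p11:
  fixes n :: nat
  assumes "n > 0"
  shows "total_cinema n \<le> (\<Prod>i = 1..n. tau i)"
proof -
  let ?F = "\<Pi>\<^sub>E i\<in>{1..n}. {d. d dvd i}"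
  have "finite ?F"
    by (intro finite_PiE) auto
  moreover have "seat_labels n ` {\<sigma>. cinema_mapping n \<sigma>} \<subseteq> ?F"
    using seat_labels_dvd by (auto simp: PiE_iff) (auto simp: seat_labels_def)
  ultimately have "total_cinema n \<le> card ?F"
    unfolding total_cinema_def using inj_on_seat_labels by (metis card_inj_on_le)
  then show ?thesis
    by (simp add: card_PiE tau_def)
qed

end
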